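(* Let $\mathbb{G}=\bigcup\limits_{i=1}^m \mathbb{G}_i$ be the disjoint union of compliant graphs $\mathbb{G}_1, \mathbb{G}_2,...,\mathbb{G}_m$, then for every vertex $a\in V(\mathbb{G}_i)$ $$_{\mathbb{G}}d_{td}(a)={_{\mathbb{G}_i}d_{td}}(a)+\sum\limits_{\substack{{j=1}\\ j\neq i}}^m\gamma_{t}(\mathbb{G}_j).$$
   Context: A total dominating set (TDS) of a graph without isolated vertices is a vertex set $S$ such that every vertex is adjacent to a vertex of $S$; a minimal TDS (MTDS) has no proper subset that is a TDS; $\gamma_t$ is the minimum cardinality of a TDS. A vertex is compliant if some MTDS contains it; a graph is compliant if all its vertices are compliant. For a vertex $a$ of a compliant graph $\mathbb{H}$, $_{\mathbb{H}}d_{td}(a)=\min\{|S| : S \text{ is an MTDS of } \mathbb{H} \text{ containing } a\}$ (total domination degree in $\mathbb{H}$). *)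

theory Defs
  imports "Graph_Theory.Pair_Digraph" "HOL-Library.Disjoint_Sets"
begin

text \<open>
  Finite simple graphs are the graphs \<open>G\<close> with \<open>pair_graph G\<close>: \<open>parcs G\<close> is then the
  adjacency relation, symmetric and irreflexive on the finite set \<open>pverts G\<close>.
\<close>

text \<open>
  The requirement that \<open>G\<close> has no isolated vertex is not repeated: a graph with an isolated
  vertex has no total dominating set in the following sense, and hence no minimal one, so that
  it is not compliant either.
\<close>

definition total_dominating_set :: "'a pair_pre_digraph \<Rightarrow> 'a set \<Rightarrow> bool" where
  "total_dominating_set G S \<longleftrightarrow>
     S \<subseteq> pverts G \<and> (\<forall>v\<in>pverts G. \<exists>u\<in>S. (v, u) \<in> parcs G)"

definition minimal_tds :: "'a pair_pre_digraph \<Rightarrow> 'a set \<Rightarrow> bool" where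
  "minimal_tds G S \<longleftrightarrow>
     total_dominating_set G S \<and> (\<forall>T. T \<subset> S \<longrightarrow> \<not> total_dominating_set G T)"

definition total_domination_number :: "'a pair_pre_digraph \<Rightarrow> nat" where
  "total_domination_number G = Min (card ` {S. total_dominating_set G S})"

definition compliant_vertex :: "'a pair_pre_digraph \<Rightarrow> 'a \<Rightarrow> bool" where
  "compliant_vertex G a \<longleftrightarrow> (\<exists>S. minimal_tds G S \<and> a \<in> S)"

definition compliant :: "'a pair_pre_digraph \<Rightarrow> bool" where
  "compliant G \<longleftrightarrow> (\<forall>a\<in>pverts G. compliant_vertex G a)"

definition total_domination_degree :: "'a pair_pre_digraph \<Rightarrow> 'a \<Rightarrow> nat" where
  "total_domination_degree G a = Min (card ` {S. minimal_tds G S \<and> a \<in> S})"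

text \<open>
  This is the disjoint union when the vertex sets of the \<open>G j\<close>, \<open>j \<in> I\<close>, are pairwise disjoint.
\<close>

definition graph_Union :: "'i set \<Rightarrow> ('i \<Rightarrow> 'a pair_pre_digraph) \<Rightarrow> 'a pair_pre_digraph" where
  "graph_Union I G = \<lparr> pverts = (\<Union>j\<in>I. pverts (G j)), parcs = (\<Union>j\<in>I. parcs (G j)) \<rparr>"

end

theory Submission
  imports Defs
begin

text \<open>
  A set of vertices of a disjoint union is a minimal total dominating set iff its trace on every
  component is one. Its cardinality is the sum of the cardinalities of the traces, which can be
  minimised independently; only the trace on the component of \<open>a\<close> is required to contain \<open>a\<close>.
\<close>

text \<open>Both domination parameters are defined by \<open>Min\<close>, which has its intended
  meaning only on finite nonempty sets. This supplies the finiteness: every total dominating set is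
  a subset of the finite vertex set.\<close>

lemma finite_total_dominating_sets:
  assumes "pair_graph G"
  shows "finite {S. total_dominating_set G S}"
proof -
  interpret pair_graph G by fact
  have "{S. total_dominating_set G S} \<subseteq> Pow (pverts G)"
    by (auto simp: total_dominating_set_def)
  then show ?thesis
    by (rule finite_subset) simp
qed

lemma finite_minimal_tds:
  assumes "pair_graph G"
  shows "finite {S. minimal_tds G S \<and> P S}"
  by (rule finite_subset[OF _ finite_total_dominating_sets[OF assms]])
    (auto simp: minimal_tds_def)

lemma total_domination_number_le_card:
  assumes "pair_graph G" "total_dominating_set G S"
  shows "total_domination_number G \<le> card S"
  unfolding total_domination_number_def
  using assms by (auto intro!: Min_le finite_total_dominating_sets)

lemma total_domination_degree_le_card:
  assumes "pair_graph G" "minimal_tds G S" "a \<in> S"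
  shows "total_domination_degree G a \<le> card S"
  unfolding total_domination_degree_def
  using assms by (auto intro!: Min_le finite_minimal_tds)

text \<open>This supplies the nonemptiness needed for \<open>Min\<close>. Compliance is vacuous for
  a graph without vertices, so there the empty set serves as witness; otherwise any vertex lies in
  some minimal total dominating set.\<close>

lemma compliant_imp_total_dominating_set:
  assumes "compliant G"
  obtains S where "total_dominating_set G S"
proof (cases "pverts G = {}")
  case True
  then have "total_dominating_set G {}"
    by (simp add: total_dominating_set_def)
  then show ?thesis by (rule that)
next
  case False
  then show ?thesis
    using assms that by (auto simp: compliant_def compliant_vertex_def minimal_tds_def)
qed

text \<open>A proper subset of a finite set has smaller cardinality, so a total dominating set of
  minimum cardinality is automatically minimal. Minimality is what allows such sets to be glued into
  a minimal total dominating set of the union.\<close>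

lemma total_domination_number_attained:
  assumes "pair_graph G" "compliant G"
  obtains S where "minimal_tds G S" "card S = total_domination_number G"
proof -
  interpret pair_graph G by fact
  have "total_domination_number G \<in> card ` {S. total_dominating_set G S}"
    unfolding total_domination_number_def
    using compliant_imp_total_dominating_set[OF assms(2)] finite_total_dominating_sets[OF assms(1)]
    by (intro Min_in) blast+
  then obtain S where S: "total_dominating_set G S" "card S = total_domination_number G"
    by auto
  then have "finite S"
    by (auto simp: total_dominating_set_def intro: finite_subset)
  then have "\<not> total_dominating_set G T" if "T \<subset> S" for T
    using total_domination_number_le_card[OF assms(1), of T] psubset_card_mono[OF _ that] S(2)
    by auto
  with S show ?thesis
    by (intro that) (auto simp: minimal_tds_def)
qed

lemma total_domination_degree_attained:
  assumes "pair_graph G" "compliant_vertex G a"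
  obtains S where "minimal_tds G S" "a \<in> S" "card S = total_domination_degree G a"
proof -
  have "total_domination_degree G a \<in> card ` {S. minimal_tds G S \<and> a \<in> S}"
    unfolding total_domination_degree_def
    using assms(2) finite_minimal_tds[OF assms(1)]
    by (intro Min_in) (auto simp: compliant_vertex_def)
  then show ?thesis
    using that by auto
qed

locale disjoint_pair_graphs =
  fixes I :: "'i set" and G :: "'i \<Rightarrow> 'a pair_pre_digraph"
  assumes finite_index: "finite I"
    and pair_graph: "j \<in> I \<Longrightarrow> pair_graph (G j)"
    and disjoint: "disjoint_family_on (\<lambda>j. pverts (G j)) I"
begin

lemma arc_in_verts:
  assumes "j \<in> I" "(v, u) \<in> parcs (G j)"
  shows "v \<in> pverts (G j)" "u \<in> pverts (G j)"
proof -
  interpret pair_graph "G j" by (rule pair_graph) fact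
  show "v \<in> pverts (G j)" "u \<in> pverts (G j)"
    using assms(2) by (auto dest: in_arcsD1 in_arcsD2)
qed

lemma finite_verts:
  assumes "j \<in> I"
  shows "finite (pverts (G j))"
proof -
  interpret pair_graph "G j" by (rule pair_graph) fact
  show ?thesis by (rule pair_finite_verts)
qed

lemma index_unique: "j \<in> I \<Longrightarrow> k \<in> I \<Longrightarrow> v \<in> pverts (G j) \<Longrightarrow> v \<in> pverts (G k) \<Longrightarrow> j = k"
  using disjoint by (auto simp: disjoint_family_on_def)

text \<open>Every arc stays within one component and every vertex belongs to only one, so a vertex
  of \<open>G j\<close> has the same neighbours in the union as in \<open>G j\<close>.\<close>

lemma total_dominating_set_graph_Union_iff:
  "total_dominating_set (graph_Union I G) S \<longleftrightarrow>
     S \<subseteq> (\<Union>j\<in>I. pverts (G j)) \<and> (\<forall>j\<in>I. total_dominating_set (G j) (S \<inter> pverts (G j)))"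
proof -
  have "(\<exists>u\<in>S. \<exists>k\<in>I. (v, u) \<in> parcs (G k)) \<longleftrightarrow> (\<exists>u\<in>S \<inter> pverts (G j). (v, u) \<in> parcs (G j))"
    if "j \<in> I" "v \<in> pverts (G j)" for j v
    using that arc_in_verts index_unique by blast
  then show ?thesis
    by (auto simp: total_dominating_set_def graph_Union_def)
qed

lemma minimal_tds_graph_Union_iff:
  "minimal_tds (graph_Union I G) S \<longleftrightarrow>
     S \<subseteq> (\<Union>j\<in>I. pverts (G j)) \<and> (\<forall>j\<in>I. minimal_tds (G j) (S \<inter> pverts (G j)))"
proof safe
  assume min: "minimal_tds (graph_Union I G) S"
  then have tds: "S \<subseteq> (\<Union>j\<in>I. pverts (G j))"
      "\<And>j. j \<in> I \<Longrightarrow> total_dominating_set (G j) (S \<inter> pverts (G j))"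
    by (auto simp: minimal_tds_def total_dominating_set_graph_Union_iff)
  then show "v \<in> (\<Union>j\<in>I. pverts (G j))" if "v \<in> S" for v
    using that by blast
  fix j assume j: "j \<in> I"
  have False if T: "T \<subset> S \<inter> pverts (G j)" "total_dominating_set (G j) T" for T
  proof -
    \<comment> \<open>Exchange argument: the trace of \<open>S\<close> on \<open>G j\<close> is
      replaced by the smaller \<open>T\<close>. By disjointness the other traces do not change, so
      the result is a total dominating set of the union properly contained in
      \<open>S\<close>.\<close>
    let ?T = "(S - pverts (G j)) \<union> T"
    have "?T \<inter> pverts (G k) = (if k = j then T else S \<inter> pverts (G k))" if "k \<in> I" for k
      using T(1) index_unique[OF j that] by auto
    then have "total_dominating_set (graph_Union I G) ?T"
      using tds T by (auto simp: total_dominating_set_graph_Union_iff)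
    moreover have "?T \<subset> S"
      using T(1) by blast
    ultimately show False
      using min by (auto simp: minimal_tds_def)
  qed
  then show "minimal_tds (G j) (S \<inter> pverts (G j))"
    using tds(2)[OF j] by (auto simp: minimal_tds_def)
next
  assume S: "S \<subseteq> (\<Union>j\<in>I. pverts (G j))" "\<forall>j\<in>I. minimal_tds (G j) (S \<inter> pverts (G j))"
  have False if T: "T \<subset> S" "total_dominating_set (graph_Union I G) T" for T
  proof -
    \<comment> \<open>Minimality of each trace of \<open>S\<close> forbids \<open>T\<close> to be
      smaller on any component. As the components cover \<open>S\<close>, this gives
      \<open>S \<subseteq> T\<close>.\<close>
    have "T \<inter> pverts (G j) = S \<inter> pverts (G j)" if "j \<in> I" for j
    proof -
      have "total_dominating_set (G j) (T \<inter> pverts (G j))"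
        using T(2) that by (simp add: total_dominating_set_graph_Union_iff)
      moreover have "T \<inter> pverts (G j) \<subseteq> S \<inter> pverts (G j)"
        using T(1) by blast
      ultimately show ?thesis
        using S(2) that by (auto simp: minimal_tds_def)
    qed
    then have "S \<subseteq> T"
      using S(1) by blast
    with T(1) show False by blast
  qed
  moreover have "total_dominating_set (graph_Union I G) S"
    using S by (simp add: minimal_tds_def total_dominating_set_graph_Union_iff)
  ultimately show "minimal_tds (graph_Union I G) S"
    unfolding minimal_tds_def by blast
qed

lemma card_eq_sum_card_Int_verts:
  assumes "S \<subseteq> (\<Union>j\<in>I. pverts (G j))"
  shows "card S = (\<Sum>j\<in>I. card (S \<inter> pverts (G j)))"
proof -
  have "card (\<Union>j\<in>I. S \<inter> pverts (G j)) = (\<Sum>j\<in>I. card (S \<inter> pverts (G j)))"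
    using finite_index finite_verts index_unique by (intro card_UN_disjoint) auto
  moreover have "(\<Union>j\<in>I. S \<inter> pverts (G j)) = S"
    using assms by blast
  ultimately show ?thesis by simp
qed

lemma total_domination_degree_graph_Union:
  assumes "\<And>j. j \<in> I \<Longrightarrow> compliant (G j)" "i \<in> I" "a \<in> pverts (G i)"
  shows "total_domination_degree (graph_Union I G) a =
    total_domination_degree (G i) a + (\<Sum>j\<in>I - {i}. total_domination_number (G j))"
    (is "_ = ?d + ?s")
proof -
  have card_split: "card S = card (S \<inter> pverts (G i)) + (\<Sum>j\<in>I - {i}. card (S \<inter> pverts (G j)))"
    if "S \<subseteq> (\<Union>j\<in>I. pverts (G j))" for S
    using card_eq_sum_card_Int_verts[OF that] finite_index assms(2) by (simp add: sum.remove)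
  obtain A where A: "minimal_tds (G i) A" "a \<in> A" "card A = ?d"
    using total_domination_degree_attained assms pair_graph by (metis compliant_def)
  have "\<exists>S. minimal_tds (G j) S \<and> card S = total_domination_number (G j)" if "j \<in> I" for j
    using total_domination_number_attained[OF pair_graph assms(1)] that by metis
  then obtain B where B: "\<And>j. j \<in> I \<Longrightarrow> minimal_tds (G j) (B j)"
      "\<And>j. j \<in> I \<Longrightarrow> card (B j) = total_domination_number (G j)"
    by metis
  \<comment> \<open>The optimal choice on each component: \<open>A\<close>, a smallest minimal total
    dominating set containing \<open>a\<close>, on \<open>G i\<close>, and a minimum total
    dominating set elsewhere. Their union attains the claimed value.\<close>
  define C where "C = B(i := A)"
  have C: "minimal_tds (G j) (C j)" if "j \<in> I" for j
    using A B that by (simp add: C_def)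
  then have C_verts: "C j \<subseteq> pverts (G j)" if "j \<in> I" for j
    using that by (auto simp: minimal_tds_def total_dominating_set_def)
  let ?S = "\<Union>j\<in>I. C j"
  have S_Int: "?S \<inter> pverts (G j) = C j" if "j \<in> I" for j
    using C_verts index_unique that by blast
  have S_verts: "?S \<subseteq> (\<Union>j\<in>I. pverts (G j))"
    using C_verts by blast
  have S: "minimal_tds (graph_Union I G) ?S"
    using C S_Int S_verts by (simp add: minimal_tds_graph_Union_iff)
  have a_S: "a \<in> ?S"
    using A(2) assms(2) by (auto simp: C_def)
  have card_S: "card ?S = ?d + ?s"
    using card_split[OF S_verts] S_Int assms(2) A(3) B(2) by (simp add: C_def)
  \<comment> \<open>Lower bound, component by component: since \<open>a\<close> is a vertex of
    \<open>G i\<close>, the trace of \<open>T\<close> on \<open>G i\<close> contains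
    \<open>a\<close> and has at least \<open>?d\<close> elements; every other trace is a total
    dominating set of its component.\<close>
  have "?d + ?s \<le> card T" if T: "minimal_tds (graph_Union I G) T" "a \<in> T" for T
  proof -
    have T_Int: "minimal_tds (G j) (T \<inter> pverts (G j))" if "j \<in> I" for j
      using T(1) that by (simp add: minimal_tds_graph_Union_iff)
    have "?d \<le> card (T \<inter> pverts (G i))"
      using T(2) T_Int assms by (intro total_domination_degree_le_card pair_graph) auto
    moreover have "?s \<le> (\<Sum>j\<in>I - {i}. card (T \<inter> pverts (G j)))"
      using T_Int
      by (intro sum_mono total_domination_number_le_card pair_graph) (auto simp: minimal_tds_def)
    ultimately show ?thesis
      using card_split[of T] T(1) by (simp add: minimal_tds_graph_Union_iff)
  qed
  \<comment> \<open>Finiteness is read off from the finite union of vertex sets, which avoids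
    proving that \<open>graph_Union I G\<close> is itself a \<open>pair_graph\<close>.\<close>
  moreover have "finite {T. minimal_tds (graph_Union I G) T \<and> a \<in> T}"
  proof (rule finite_subset)
    show "{T. minimal_tds (graph_Union I G) T \<and> a \<in> T} \<subseteq> Pow (\<Union>j\<in>I. pverts (G j))"
      by (auto simp: minimal_tds_graph_Union_iff)
  qed (use finite_index finite_verts in simp)
  ultimately show ?thesis
    unfolding total_domination_degree_def[of "graph_Union I G"]
    using S a_S card_S by (intro Min_eqI) force+
qed

end

theorem theorem7:
  fixes G :: "nat \<Rightarrow> 'a pair_pre_digraph" and m i :: nat and a :: 'a
  assumes "\<And>j. j \<in> {1..m} \<Longrightarrow> pair_graph (G j)"
    and "\<And>j. j \<in> {1..m} \<Longrightarrow> compliant (G j)"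
    and "disjoint_family_on (\<lambda>j. pverts (G j)) {1..m}"
    and "i \<in> {1..m}"
    and "a \<in> pverts (G i)"
  shows "total_domination_degree (graph_Union {1..m} G) a =
    total_domination_degree (G i) a + (\<Sum>j\<in>{1..m} - {i}. total_domination_number (G j))"
proof -
  interpret disjoint_pair_graphs "{1..m}" G
    using assms by (intro disjoint_pair_graphs.intro) simp_all
  show ?thesis
    using assms by (intro total_domination_degree_graph_Union)
qed

end
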